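(* Let $G$ and $H$ be two strongly connected digraphs, each of order at least $2$. Then $$\lambda_2(G\Box H)\ge \lambda_2(G)+\lambda_2(H)-1.$$
   Context: All digraphs are finite, without loops or parallel arcs. For a digraph $D$ and $S\subseteq V(D)$, an $S$-strong subgraph is a strongly connected subgraph of $D$ containing all vertices of $S$; $\lambda_S(D)$ is the maximum number of pairwise arc-disjoint $S$-strong subgraphs of $D$; and $\lambda_2(D)=\min\{\lambda_S(D): S\subseteq V(D),\ |S|=2\}$. The Cartesian product $G\Box H$ has vertex set $V(G)\times V(H)$, and $(x,x')(y,y')$ is an arc iff either $xy\in A(G)$ and $x'=y'$, or $x=y$ and $x'y'\in A(H)$. *)

theory Defs
  imports "Graph_Theory.Digraph_Component"
begin

definition cartesian_product ::
  "'a pair_pre_digraph \<Rightarrow> 'b pair_pre_digraph \<Rightarrow> ('a \<times> 'b) pair_pre_digraph"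
  (infixr \<open>\<box>\<close> 80) where
  "G \<box> H = \<lparr>
     pverts = pverts G \<times> pverts H,
     parcs = {((x, x'), (y, y')) | x x' y y'.
       (x, x') \<in> pverts G \<times> pverts H \<and> (y, y') \<in> pverts G \<times> pverts H \<and>
       ((x, y) \<in> parcs G \<and> x' = y' \<or> x = y \<and> (x', y') \<in> parcs H)} \<rparr>"

definition strong_subgraph ::
  "'a pair_pre_digraph \<Rightarrow> 'a set \<Rightarrow> 'a pair_pre_digraph \<Rightarrow> bool" where
  "strong_subgraph D S F \<longleftrightarrow>
     subgraph (with_proj F) (with_proj D) \<and> strongly_connected (with_proj F) \<and> S \<subseteq> pverts F"

definition strong_packing ::
  "'a pair_pre_digraph \<Rightarrow> 'a set \<Rightarrow> 'a pair_pre_digraph set \<Rightarrow> bool" where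
  "strong_packing D S \<F> \<longleftrightarrow>
     (\<forall>F\<in>\<F>. strong_subgraph D S F) \<and>
     pairwise (\<lambda>F F'. parcs F \<inter> parcs F' = {}) \<F>"

text \<open>
  A packing is a set of subgraphs, which loses nothing when \<open>2 \<le> card S\<close>: every \<open>S\<close>-strong
  subgraph then has an arc, so arc-disjoint members of a family are distinct.
\<close>

definition lambda_S :: "'a pair_pre_digraph \<Rightarrow> 'a set \<Rightarrow> nat" where
  "lambda_S D S = Max {card \<F> | \<F>. strong_packing D S \<F>}"

definition lambda_2 :: "'a pair_pre_digraph \<Rightarrow> nat" where
  "lambda_2 D = Min {lambda_S D S | S. S \<subseteq> pverts D \<and> card S = 2}"

lemma pair_digraph_cartesian_product:
  assumes "pair_digraph G" "pair_digraph H"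
  shows "pair_digraph (G \<box> H)"
proof -
  interpret G: pair_digraph G by fact
  interpret H: pair_digraph H by fact
  have "parcs (G \<box> H) \<subseteq> (pverts G \<times> pverts H) \<times> (pverts G \<times> pverts H)"
    by (auto simp: cartesian_product_def)
  then have "finite (parcs (G \<box> H))"
    by (rule finite_subset) (simp)
  then show ?thesis
    by unfold_locales
      (auto simp: cartesian_product_def dest: G.no_loops' H.no_loops')
qed

text \<open>The maximum and the minimum above are taken over finite nonempty sets.\<close>

lemma finite_strong_packings:
  assumes "pair_digraph D"
  shows "finite {\<F>. strong_packing D S \<F>}"
proof -
  interpret pair_digraph D by fact
  let ?A = "(\<lambda>(V, A). \<lparr>pverts = V, parcs = A\<rparr>) ` (Pow (pverts D) \<times> Pow (parcs D))"
  have "F \<in> ?A" if "strong_subgraph D S F" for F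
    using that by (cases F) (auto simp: strong_subgraph_def subgraph_def image_iff)
  then have "{\<F>. strong_packing D S \<F>} \<subseteq> Pow ?A"
    unfolding strong_packing_def by blast
  moreover have "finite (Pow ?A)"
    by simp
  ultimately show ?thesis
    by (rule finite_subset)
qed

lemma finite_packing_sizes:
  assumes "pair_digraph D"
  shows "finite {card \<F> | \<F>. strong_packing D S \<F>}"
  unfolding setcompr_eq_image by (rule finite_imageI[OF finite_strong_packings[OF assms]])

lemma packing_sizes_nonempty: "{card \<F> | \<F>. strong_packing D S \<F>} \<noteq> {}"
proof -
  have "strong_packing D S {}"
    by (simp add: strong_packing_def)
  then show ?thesis
    by blast
qed

lemma finite_lambda_S_values:
  assumes "pair_digraph D"
  shows "finite {lambda_S D S | S. S \<subseteq> pverts D \<and> card S = 2}"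
proof -
  interpret pair_digraph D by fact
  show ?thesis
    by (rule finite_subset[of _ "lambda_S D ` Pow (pverts D)"]) auto
qed

lemma lambda_S_values_nonempty:
  assumes "2 \<le> card (pverts D)"
  shows "{lambda_S D S | S. S \<subseteq> pverts D \<and> card S = 2} \<noteq> {}"
proof -
  obtain S where "S \<subseteq> pverts D" "card S = 2"
    using obtain_subset_with_card_n[OF assms] by metis
  then show ?thesis
    by blast
qed

end

theory Submission
  imports Defs
begin

text \<open>The product contains a row, that is a copy of \<open>G\<close>, for every vertex of
  \<open>H\<close>, and a column, that is a copy of \<open>H\<close>, for every vertex of
  \<open>G\<close>. Rows and columns never share an arc because \<open>G\<close> has no loops. Given
  two vertices of the product, maximum packings of \<open>G\<close> and \<open>H\<close> for
  suitable pairs of coordinates are turned into one packing of the product.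

  A member K of the packing of \<open>H\<close> is copied into the columns of the two given
  vertices, and the two copies are tied together by a whole row. The row is taken at the end v K of
  an arc of K leaving c, the \<open>H\<close>-coordinate of the first given vertex. Arc-disjoint
  members leave c towards different vertices (\<open>obtain_distinct_out_neighbours\<close>), so
  different members use different rows. Members of the packing of \<open>G\<close> can likewise be
  copied into two rows and tied by a whole column.

  If the given vertices lie in one row, the members of the packing of \<open>G\<close> are simply
  copied into that row, the ties lie in other rows, and nothing is lost
  (\<open>lambda_S_product_same_row\<close>); a common column is the mirror image. If the vertices
  are (x, c) and (y, d) with both coordinates different, a tie may collide with a copy, namely when
  it runs in column y or row d; then the member contains the arc (x, y) or (c, d), which happens for
  at most one member of each packing. One such member is set aside on each side, and these two,
  placed in row c and column y and meeting in (y, c), form one further subgraph. The loss is exactly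
  one (\<open>lambda_S_product_general\<close>).\<close>

section \<open>Strong connectivity of pair digraphs, their images and unions\<close>

definition strong_pair :: "'a pair_pre_digraph \<Rightarrow> bool" where
  "strong_pair F \<longleftrightarrow> parcs F \<subseteq> pverts F \<times> pverts F \<and> pverts F \<noteq> {} \<and>
     (\<forall>u\<in>pverts F. \<forall>v\<in>pverts F. (u, v) \<in> (parcs F)\<^sup>*)"

text \<open>Arcs with both ends in \<open>V\<close> keep every walk from \<open>u\<close> inside
  \<open>V\<close>, so the restriction built into \<open>rtrancl_on\<close> is vacuous.\<close>

lemma rtrancl_on_eq_rtrancl:
  assumes "R \<subseteq> V \<times> V" "u \<in> V"
  shows "(u, v) \<in> rtrancl_on V R \<longleftrightarrow> (u, v) \<in> R\<^sup>*"
proof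
  assume "(u, v) \<in> rtrancl_on V R"
  then show "(u, v) \<in> R\<^sup>*"
    by induction (auto intro: rtrancl_into_rtrancl)
next
  assume "(u, v) \<in> R\<^sup>*"
  then show "(u, v) \<in> rtrancl_on V R"
    by induction (use assms in \<open>auto intro: rtrancl_on_into_rtrancl_on\<close>)
qed

text \<open>Replaces reachability in a digraph by the plain closure of the arc relation, which
  behaves well under images and unions.\<close>

lemma strong_pair_iff:
  "strong_pair F \<longleftrightarrow> wf_digraph (with_proj F) \<and> strongly_connected (with_proj F)"
proof -
  have ends: "arcs_ends (with_proj F) = parcs F"
    by (auto simp: arcs_ends_def arc_to_ends_def)
  have wf: "wf_digraph (with_proj F) \<longleftrightarrow> parcs F \<subseteq> pverts F \<times> pverts F"
    by (auto simp: wf_digraph_def)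
  show ?thesis
    unfolding strong_pair_def wf strongly_connected_def reachable_def ends
    by (auto simp: rtrancl_on_eq_rtrancl)
qed

lemma strong_subgraph_iff:
  assumes "pair_digraph D"
  shows "strong_subgraph D S F \<longleftrightarrow>
    pverts F \<subseteq> pverts D \<and> parcs F \<subseteq> parcs D \<and> strong_pair F \<and> S \<subseteq> pverts F"
proof -
  interpret pair_digraph D by fact
  have "wf_digraph (with_proj D)" ..
  then show ?thesis
    by (auto simp: strong_subgraph_def subgraph_def strong_pair_iff compatible_def)
qed

definition graph_image :: "('a \<Rightarrow> 'b) \<Rightarrow> 'a pair_pre_digraph \<Rightarrow> 'b pair_pre_digraph" where
  "graph_image f F = \<lparr>pverts = f ` pverts F, parcs = map_prod f f ` parcs F\<rparr>"

definition graph_join ::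
  "'a pair_pre_digraph \<Rightarrow> 'a pair_pre_digraph \<Rightarrow> 'a pair_pre_digraph" where
  "graph_join F K = \<lparr>pverts = pverts F \<union> pverts K, parcs = parcs F \<union> parcs K\<rparr>"

lemma graph_image_simps [simp]:
  "pverts (graph_image f F) = f ` pverts F"
  "parcs (graph_image f F) = map_prod f f ` parcs F"
  by (simp_all add: graph_image_def)

lemma graph_join_simps [simp]:
  "pverts (graph_join F K) = pverts F \<union> pverts K"
  "parcs (graph_join F K) = parcs F \<union> parcs K"
  by (simp_all add: graph_join_def)

lemma strong_pair_image:
  assumes "strong_pair F"
  shows "strong_pair (graph_image f F)"
proof -
  have "(f u, f v) \<in> (map_prod f f ` parcs F)\<^sup>*" if "(u, v) \<in> (parcs F)\<^sup>*" for u v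
    using that
  proof induction
    case (step v w)
    then have "(f v, f w) \<in> map_prod f f ` parcs F"
      by force
    with step.IH show ?case
      by (rule rtrancl_into_rtrancl)
  qed simp
  then show ?thesis
    using assms by (auto simp: strong_pair_def)
qed

text \<open>Every vertex of either part reaches \<open>z\<close> and is reached from
  \<open>z\<close>, so any two vertices are connected through \<open>z\<close>.\<close>

lemma strong_pair_join:
  assumes "strong_pair F" "strong_pair K" "z \<in> pverts F" "z \<in> pverts K"
  shows "strong_pair (graph_join F K)"
proof -
  let ?R = "(parcs F \<union> parcs K)\<^sup>*"
  have sub: "(parcs F)\<^sup>* \<subseteq> ?R" "(parcs K)\<^sup>* \<subseteq> ?R"
    by (auto intro: rtrancl_mono[THEN subsetD, rotated])
  have "(u, z) \<in> ?R \<and> (z, u) \<in> ?R" if "u \<in> pverts F \<union> pverts K" for u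
    using that assms sub unfolding strong_pair_def by blast
  then have "(u, v) \<in> ?R" if "u \<in> pverts F \<union> pverts K" "v \<in> pverts F \<union> pverts K" for u v
    using that by (blast intro: rtrancl_trans)
  then show ?thesis
    using assms unfolding strong_pair_def graph_join_simps by blast
qed

text \<open>The required arc is the first one on a walk from \<open>x\<close> to
  \<open>y\<close>.\<close>

lemma strong_pair_out_arc:
  assumes "strong_pair F" "x \<in> pverts F" "y \<in> pverts F" "x \<noteq> y"
  obtains u where "(x, u) \<in> parcs F"
proof -
  have "(x, y) \<in> (parcs F)\<^sup>*"
    using assms by (auto simp: strong_pair_def)
  then show ?thesis
    using that \<open>x \<noteq> y\<close> by (metis converse_rtranclE)
qed

section \<open>Packings and their maximum size\<close>

lemma card_2_distinct_members:
  assumes "card S = 2"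
  obtains x y where "x \<in> S" "y \<in> S" "x \<noteq> y"
  using assms by (auto simp: card_2_iff)

text \<open>Allows packings to be given as indexed families. Two distinct vertices in
  \<open>S\<close> force an arc into every member, so disjointness makes the family injective and
  the index set can be counted instead of its image.\<close>

lemma card_le_lambda_S:
  assumes D: "pair_digraph D" and S: "card S = 2"
    and strong: "\<And>i. i \<in> I \<Longrightarrow> strong_subgraph D S (F i)"
    and disj: "\<And>i j. i \<in> I \<Longrightarrow> j \<in> I \<Longrightarrow> i \<noteq> j \<Longrightarrow> parcs (F i) \<inter> parcs (F j) = {}"
  shows "card I \<le> lambda_S D S"
proof -
  obtain x y where xy: "x \<in> S" "y \<in> S" "x \<noteq> y"
    using card_2_distinct_members[OF S] .
  have "parcs (F i) \<noteq> {}" if "i \<in> I" for i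
  proof -
    have "strong_pair (F i)" "x \<in> pverts (F i)" "y \<in> pverts (F i)"
      using strong[OF that] xy by (auto simp: strong_subgraph_iff[OF D])
    then show ?thesis
      using strong_pair_out_arc[OF _ _ _ \<open>x \<noteq> y\<close>] by (metis empty_iff)
  qed
  then have "inj_on F I"
    using disj by (metis inf.idem inj_onI)
  then have "card I = card (F ` I)"
    by (simp add: card_image)
  moreover have "strong_packing D S (F ` I)"
    using strong disj by (fastforce simp: strong_packing_def pairwise_def)
  ultimately show ?thesis
    unfolding lambda_S_def using finite_packing_sizes[OF D] by (intro Max_ge) auto
qed

lemma obtain_max_packing:
  assumes "pair_digraph D"
  obtains \<F> where "strong_packing D S \<F>" "card \<F> = lambda_S D S"
proof -
  have "lambda_S D S \<in> {card \<F> | \<F>. strong_packing D S \<F>}"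
    unfolding lambda_S_def
    using finite_packing_sizes[OF assms] packing_sizes_nonempty by (rule Max_in)
  then show ?thesis
    using that by auto
qed

text \<open>All subsets of a packing are packings, and there are only finitely many
  packings.\<close>

lemma finite_packing:
  assumes "pair_digraph D" "strong_packing D S \<F>"
  shows "finite \<F>"
proof -
  have "Pow \<F> \<subseteq> {\<F>'. strong_packing D S \<F>'}"
    using assms(2) by (auto simp: strong_packing_def intro: pairwise_subset)
  then show ?thesis
    using finite_strong_packings[OF assms(1)] by (metis finite_Pow_iff finite_subset)
qed

lemma lambda_2_le_lambda_S:
  assumes "pair_digraph D" "S \<subseteq> pverts D" "card S = 2"
  shows "lambda_2 D \<le> lambda_S D S"
  unfolding lambda_2_def using finite_lambda_S_values[OF assms(1)] assms(2,3)
  by (intro Min_le) auto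

text \<open>The digraph itself is a packing with one member. This guarantees that there is a member
  to set aside in the general case.\<close>

lemma lambda_S_pos:
  assumes "pair_digraph D" "strong_pair D" "S \<subseteq> pverts D" "card S = 2"
  shows "1 \<le> lambda_S D S"
  using card_le_lambda_S[OF assms(1,4), of "{()}" "\<lambda>_. D"] assms(2,3)
  by (simp add: strong_subgraph_iff[OF assms(1)])

text \<open>An injective map keeps arc-disjoint subgraphs arc-disjoint. Applied to the swap of
  coordinates, it exchanges the roles of the two factors.\<close>

lemma lambda_S_le_image:
  assumes D: "pair_digraph D" and D': "pair_digraph D'" and f: "inj f"
    and sub: "f ` pverts D \<subseteq> pverts D'" "map_prod f f ` parcs D \<subseteq> parcs D'"
    and S: "card S = 2"
  shows "lambda_S D S \<le> lambda_S D' (f ` S)"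
proof -
  obtain \<F> where \<F>: "strong_packing D S \<F>" "card \<F> = lambda_S D S"
    using obtain_max_packing[OF D] .
  have "card \<F> \<le> lambda_S D' (f ` S)"
  proof (rule card_le_lambda_S[OF D', where F = "graph_image f"])
    show "card (f ` S) = 2"
      using S f by (simp add: card_image inj_on_subset)
    show "strong_subgraph D' (f ` S) (graph_image f F)" if "F \<in> \<F>" for F
      using \<F>(1) that sub
      unfolding strong_packing_def strong_subgraph_iff[OF D] strong_subgraph_iff[OF D']
      by (fastforce intro: strong_pair_image)
    show "parcs (graph_image f F) \<inter> parcs (graph_image f K) = {}"
      if "F \<in> \<F>" "K \<in> \<F>" "F \<noteq> K" for F K
    proof -
      have "parcs F \<inter> parcs K = {}"
        using \<F>(1) that by (auto simp: strong_packing_def pairwise_def)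
      moreover have "inj (map_prod f f)"
        using f by (simp add: prod.inj_map)
      ultimately show ?thesis
        by (metis graph_image_simps(2) image_Int image_empty)
    qed
  qed
  then show ?thesis
    using \<F>(2) by simp
qed

text \<open>Arc-disjoint members leave a common vertex along different arcs, hence towards different
  vertices.\<close>

lemma obtain_distinct_out_neighbours:
  assumes D: "pair_digraph D" and \<F>: "strong_packing D S \<F>"
    and xy: "x \<in> S" "y \<in> S" "x \<noteq> y"
  obtains u where "inj_on u \<F>"
    and "\<And>F. F \<in> \<F> \<Longrightarrow> (x, u F) \<in> parcs F \<and> u F \<in> pverts F \<and> u F \<noteq> x"
proof -
  interpret pair_digraph D by fact
  have "\<exists>u. (x, u) \<in> parcs F \<and> u \<in> pverts F \<and> u \<noteq> x" if "F \<in> \<F>" for F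
  proof -
    have F: "parcs F \<subseteq> parcs D" "strong_pair F" "S \<subseteq> pverts F"
      using \<F> that by (auto simp: strong_packing_def strong_subgraph_iff[OF D])
    then obtain u where "(x, u) \<in> parcs F"
      using strong_pair_out_arc[of F x y] xy by blast
    then show ?thesis
      using F no_loops' unfolding strong_pair_def by blast
  qed
  then obtain u where u: "\<And>F. F \<in> \<F> \<Longrightarrow> (x, u F) \<in> parcs F \<and> u F \<in> pverts F \<and> u F \<noteq> x"
    by metis
  have "inj_on u \<F>"
    using u \<F> unfolding strong_packing_def pairwise_def inj_on_def
    by (metis disjoint_iff)
  then show ?thesis
    using that u by blast
qed

text \<open>At most one member contains \<open>e\<close>; if none does, any member can serve as
  \<open>F\<^sub>0\<close>.\<close>

lemma packing_avoid_arc: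
  assumes "strong_packing D S \<F>" "\<F> \<noteq> {}"
  obtains F\<^sub>0 where "F\<^sub>0 \<in> \<F>" "\<And>F. F \<in> \<F> \<Longrightarrow> F \<noteq> F\<^sub>0 \<Longrightarrow> e \<notin> parcs F"
  using assms unfolding strong_packing_def pairwise_def by (metis disjoint_iff ex_in_conv)

section \<open>Rows and columns of the product\<close>

abbreviation row :: "'b \<Rightarrow> 'a pair_pre_digraph \<Rightarrow> ('a \<times> 'b) pair_pre_digraph" where
  "row c \<equiv> graph_image (\<lambda>u. (u, c))"

abbreviation column :: "'a \<Rightarrow> 'b pair_pre_digraph \<Rightarrow> ('a \<times> 'b) pair_pre_digraph" where
  "column x \<equiv> graph_image (Pair x)"

lemma row_subgraph:
  assumes "strong_pair F" "pverts F \<subseteq> pverts G" "parcs F \<subseteq> parcs G" "c \<in> pverts H"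
  shows "pverts (row c F) \<subseteq> pverts (G \<box> H)" "parcs (row c F) \<subseteq> parcs (G \<box> H)"
  using assms by (fastforce simp: cartesian_product_def strong_pair_def)+

lemma column_subgraph:
  assumes "strong_pair F" "pverts F \<subseteq> pverts H" "parcs F \<subseteq> parcs H" "x \<in> pverts G"
  shows "pverts (column x F) \<subseteq> pverts (G \<box> H)" "parcs (column x F) \<subseteq> parcs (G \<box> H)"
  using assms by (fastforce simp: cartesian_product_def strong_pair_def)+

text \<open>A common arc would keep both coordinates fixed and so come from a loop of
  \<open>F\<close>.\<close>

lemma row_column_disjoint:
  assumes "pair_digraph G" "parcs F \<subseteq> parcs G"
  shows "parcs (row c F) \<inter> parcs (column x K) = {}"
proof -
  interpret pair_digraph G by fact
  show ?thesis
    using assms(2) no_loops' by auto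
qed

lemma row_row_disjoint:
  "c \<noteq> d \<or> parcs F \<inter> parcs K = {} \<Longrightarrow> parcs (row c F) \<inter> parcs (row d K) = {}"
  by auto

lemma column_column_disjoint:
  "x \<noteq> y \<or> parcs F \<inter> parcs K = {} \<Longrightarrow> parcs (column x F) \<inter> parcs (column y K) = {}"
  by auto

section \<open>Packings of the product for a given pair of vertices\<close>

text \<open>The packing of \<open>G\<close> lives in row \<open>c\<close>. Each member of the
  packing of \<open>H\<close> gives copies in columns \<open>x\<close> and \<open>y\<close>, joined
  by a row different from \<open>c\<close>. The vertex \<open>z\<close> is an arbitrary partner that
  makes \<open>c\<close> part of a pair.\<close>

lemma lambda_S_product_same_row:
  assumes G: "pair_digraph G" and H: "pair_digraph H"
    and sG: "strong_pair G"
    and xy: "x \<in> pverts G" "y \<in> pverts G" "x \<noteq> y"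
    and cz: "c \<in> pverts H" "z \<in> pverts H" "c \<noteq> z"
  shows "lambda_S G {x, y} + lambda_S H {c, z} \<le> lambda_S (G \<box> H) {(x, c), (y, c)}"
proof -
  have GH: "pair_digraph (G \<box> H)"
    using G H by (rule pair_digraph_cartesian_product)
  obtain \<G> where \<G>: "strong_packing G {x, y} \<G>" "card \<G> = lambda_S G {x, y}"
    using obtain_max_packing[OF G] .
  obtain \<H> where \<H>: "strong_packing H {c, z} \<H>" "card \<H> = lambda_S H {c, z}"
    using obtain_max_packing[OF H] .
  have fin: "finite \<G>" "finite \<H>"
    using finite_packing G H \<G>(1) \<H>(1) by blast+
  have \<G>D: "pverts F \<subseteq> pverts G" "parcs F \<subseteq> parcs G" "strong_pair F" "x \<in> pverts F" "y \<in> pverts F"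
    if "F \<in> \<G>" for F
    using \<G>(1) that by (auto simp: strong_packing_def strong_subgraph_iff[OF G])
  have \<H>D: "pverts K \<subseteq> pverts H" "parcs K \<subseteq> parcs H" "strong_pair K" "c \<in> pverts K"
    if "K \<in> \<H>" for K
    using \<H>(1) that by (auto simp: strong_packing_def strong_subgraph_iff[OF H])
  have \<G>disj: "parcs F \<inter> parcs F' = {}" if "F \<in> \<G>" "F' \<in> \<G>" "F \<noteq> F'" for F F'
    using \<G>(1) that by (auto simp: strong_packing_def pairwise_def)
  have \<H>disj: "parcs F \<inter> parcs F' = {}" if "F \<in> \<H>" "F' \<in> \<H>" "F \<noteq> F'" for F F'
    using \<H>(1) that by (auto simp: strong_packing_def pairwise_def)
  obtain v where inj: "inj_on v \<H>"
    and v: "\<And>K. K \<in> \<H> \<Longrightarrow> (c, v K) \<in> parcs K \<and> v K \<in> pverts K \<and> v K \<noteq> c"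
    using obtain_distinct_out_neighbours[OF H \<H>(1), of c z] cz by blast
  \<comment> \<open>The row at \<open>v K\<close> meets both columns because \<open>v K\<close> is a
    vertex of \<open>K\<close>; it avoids row \<open>c\<close> because \<open>v K\<close> differs
    from \<open>c\<close>.\<close>
  define T where "T K = graph_join (graph_join (column x K) (row (v K) G)) (column y K)" for K
  have T: "strong_subgraph (G \<box> H) {(x, c), (y, c)} (T K)" if K: "K \<in> \<H>" for K
  proof -
    have vK: "v K \<in> pverts H"
      using v[OF K] \<H>D(1)[OF K] by auto
    have "strong_pair (T K)"
      unfolding T_def
      apply (rule strong_pair_join[where z = "(y, v K)"])
      apply (rule strong_pair_join[where z = "(x, v K)"])
      using \<H>D[OF K] sG v[OF K] xy by (auto intro: strong_pair_image)
    moreover have "pverts (T K) \<subseteq> pverts (G \<box> H)" "parcs (T K) \<subseteq> parcs (G \<box> H)"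
      using column_subgraph[OF \<H>D(3)[OF K] \<H>D(1)[OF K] \<H>D(2)[OF K] xy(1)]
        column_subgraph[OF \<H>D(3)[OF K] \<H>D(1)[OF K] \<H>D(2)[OF K] xy(2)]
        row_subgraph[OF sG order_refl order_refl vK]
      unfolding T_def graph_join_simps by (simp_all only: Un_subset_iff)
    moreover have "{(x, c), (y, c)} \<subseteq> pverts (T K)"
      using \<H>D(4)[OF K] by (auto simp: T_def)
    ultimately show ?thesis
      by (simp add: strong_subgraph_iff[OF GH])
  qed
  have R: "strong_subgraph (G \<box> H) {(x, c), (y, c)} (row c F)" if F: "F \<in> \<G>" for F
    using row_subgraph[OF \<G>D(3)[OF F] \<G>D(1)[OF F] \<G>D(2)[OF F] cz(1)] \<G>D(3-5)[OF F]
    by (auto simp: strong_subgraph_iff[OF GH] intro: strong_pair_image)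
  have RT: "parcs (row c F) \<inter> parcs (T K) = {}" if "F \<in> \<G>" "K \<in> \<H>" for F K
    using row_column_disjoint[OF G \<G>D(2)[OF that(1)], of c _ K]
      row_row_disjoint[of c "v K" F G] v[OF that(2)]
    unfolding T_def graph_join_simps by blast
  have TT: "parcs (T K) \<inter> parcs (T L) = {}" if "K \<in> \<H>" "L \<in> \<H>" "K \<noteq> L" for K L
  proof -
    have "v K \<noteq> v L"
      using inj that by (auto dest: inj_onD)
    then have "parcs (row (v K) G) \<inter> parcs (row (v L) G) = {}"
      by (intro row_row_disjoint) simp
    moreover have "parcs (column a K) \<inter> parcs (column b L) = {}" for a b :: 'a
      using \<H>disj[OF that] by (intro column_column_disjoint) simp
    moreover have "parcs (row a G) \<inter> parcs (column b M) = {}" for a b and M :: "'b pair_pre_digraph"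
      by (rule row_column_disjoint[OF G]) simp
    ultimately show ?thesis
      unfolding T_def graph_join_simps by blast
  qed
  \<comment> \<open>Indexing by the disjoint sum makes the two packing sizes add up.\<close>
  have "card (\<G> <+> \<H>) \<le> lambda_S (G \<box> H) {(x, c), (y, c)}"
  proof (rule card_le_lambda_S[OF GH, where F = "case_sum (row c) T"])
    show "card {(x, c), (y, c)} = 2"
      using xy by simp
    show "strong_subgraph (G \<box> H) {(x, c), (y, c)} (case_sum (row c) T i)"
      if "i \<in> \<G> <+> \<H>" for i
      using that R T by auto
    show "parcs (case_sum (row c) T i) \<inter> parcs (case_sum (row c) T j) = {}"
      if "i \<in> \<G> <+> \<H>" "j \<in> \<G> <+> \<H>" "i \<noteq> j" for i j
    proof (cases i; cases j)
      fix F F' assume "i = Inl F" "j = Inl F'"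
      then show ?thesis
        using that \<G>disj[of F F'] row_row_disjoint[of c c F F'] by auto
    next
      fix F K assume "i = Inl F" "j = Inr K"
      then show ?thesis using that RT by auto
    next
      fix F K assume "i = Inr K" "j = Inl F"
      then show ?thesis using that RT by auto
    next
      fix K L assume "i = Inr K" "j = Inr L"
      then show ?thesis using that TT[of K L] by auto
    qed
  qed
  then show ?thesis
    using \<G>(2) \<H>(2) fin by (simp add: card_Plus)
qed

text \<open>The mirror image of the previous case, carried over by swapping coordinates.\<close>

lemma lambda_S_product_same_column:
  assumes G: "pair_digraph G" and H: "pair_digraph H"
    and sH: "strong_pair H"
    and xy: "x \<in> pverts H" "y \<in> pverts H" "x \<noteq> y"
    and cz: "c \<in> pverts G" "z \<in> pverts G" "c \<noteq> z"
  shows "lambda_S H {x, y} + lambda_S G {c, z} \<le> lambda_S (G \<box> H) {(c, x), (c, y)}"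
proof -
  have "lambda_S (H \<box> G) {(x, c), (y, c)} \<le> lambda_S (G \<box> H) (prod.swap ` {(x, c), (y, c)})"
    using xy
    by (intro lambda_S_le_image pair_digraph_cartesian_product G H)
      (auto simp: cartesian_product_def)
  then show ?thesis
    using lambda_S_product_same_row[OF H G sH xy cz] by simp
qed

text \<open>At most one member of each packing contains the arc between the two prescribed vertices.
  Setting one such member \<open>G0\<close>, \<open>H0\<close> of each packing aside, the remaining ones are doubled and
  joined along pairwise different columns (rows) that avoid the two prescribed vertices;
  \<open>G0\<close> and \<open>H0\<close> together give one more subgraph.\<close>

lemma lambda_S_product_general:
  assumes G: "pair_digraph G" and H: "pair_digraph H"
    and sG: "strong_pair G" and sH: "strong_pair H"
    and xy: "x \<in> pverts G" "y \<in> pverts G" "x \<noteq> y"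
    and cd: "c \<in> pverts H" "d \<in> pverts H" "c \<noteq> d"
  shows "lambda_S G {x, y} + lambda_S H {c, d} \<le> lambda_S (G \<box> H) {(x, c), (y, d)} + 1"
proof -
  have GH: "pair_digraph (G \<box> H)"
    using G H by (rule pair_digraph_cartesian_product)
  obtain \<G> where \<G>: "strong_packing G {x, y} \<G>" "card \<G> = lambda_S G {x, y}"
    using obtain_max_packing[OF G] .
  obtain \<H> where \<H>: "strong_packing H {c, d} \<H>" "card \<H> = lambda_S H {c, d}"
    using obtain_max_packing[OF H] .
  have fin: "finite \<G>" "finite \<H>"
    using finite_packing G H \<G>(1) \<H>(1) by blast+
  have ne: "\<G> \<noteq> {}" "\<H> \<noteq> {}"
    using lambda_S_pos[OF G sG, of "{x, y}"] lambda_S_pos[OF H sH, of "{c, d}"] \<G>(2) \<H>(2) xy cd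
    by auto
  have \<G>D: "pverts F \<subseteq> pverts G" "parcs F \<subseteq> parcs G" "strong_pair F" "x \<in> pverts F" "y \<in> pverts F"
    if "F \<in> \<G>" for F
    using \<G>(1) that by (auto simp: strong_packing_def strong_subgraph_iff[OF G])
  have \<H>D: "pverts K \<subseteq> pverts H" "parcs K \<subseteq> parcs H" "strong_pair K" "c \<in> pverts K" "d \<in> pverts K"
    if "K \<in> \<H>" for K
    using \<H>(1) that by (auto simp: strong_packing_def strong_subgraph_iff[OF H])
  have \<G>disj: "parcs F \<inter> parcs F' = {}" if "F \<in> \<G>" "F' \<in> \<G>" "F \<noteq> F'" for F F'
    using \<G>(1) that by (auto simp: strong_packing_def pairwise_def)
  have \<H>disj: "parcs F \<inter> parcs F' = {}" if "F \<in> \<H>" "F' \<in> \<H>" "F \<noteq> F'" for F F'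
    using \<H>(1) that by (auto simp: strong_packing_def pairwise_def)
  obtain u where inju: "inj_on u \<G>"
    and u: "\<And>F. F \<in> \<G> \<Longrightarrow> (x, u F) \<in> parcs F \<and> u F \<in> pverts F \<and> u F \<noteq> x"
    using obtain_distinct_out_neighbours[OF G \<G>(1), of x y] xy by blast
  obtain v where injv: "inj_on v \<H>"
    and v: "\<And>K. K \<in> \<H> \<Longrightarrow> (c, v K) \<in> parcs K \<and> v K \<in> pverts K \<and> v K \<noteq> c"
    using obtain_distinct_out_neighbours[OF H \<H>(1), of c d] cd by blast
  obtain G0 where G0: "G0 \<in> \<G>" "\<And>F. F \<in> \<G> \<Longrightarrow> F \<noteq> G0 \<Longrightarrow> (x, y) \<notin> parcs F"
    using packing_avoid_arc[OF \<G>(1) ne(1)] by metis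
  obtain H0 where H0: "H0 \<in> \<H>" "\<And>K. K \<in> \<H> \<Longrightarrow> K \<noteq> H0 \<Longrightarrow> (c, d) \<notin> parcs K"
    using packing_avoid_arc[OF \<H>(1) ne(2)] by metis
  \<comment> \<open>If \<open>u F\<close> were \<open>y\<close>, then \<open>F\<close> would contain
    the arc \<open>(x, y)\<close>.\<close>
  have uy: "u F \<noteq> y" if "F \<in> \<G>" "F \<noteq> G0" for F
    using u[OF that(1)] G0(2)[OF that] by metis
  have vd: "v K \<noteq> d" if "K \<in> \<H>" "K \<noteq> H0" for K
    using v[OF that(1)] H0(2)[OF that] by metis
  \<comment> \<open>For \<open>F = G0\<close> the two pieces meet in the corner
    \<open>(y, c)\<close>; this uses up \<open>H0\<close> as well. Otherwise the column at
    \<open>u F\<close> meets both rows because \<open>u F\<close> is a vertex of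
    \<open>F\<close>.\<close>
  define T where "T F = (if F = G0 then graph_join (row c G0) (column y H0)
    else graph_join (graph_join (row c F) (column (u F) H)) (row d F))" for F
  define U where "U K = graph_join (graph_join (column x K) (row (v K) G)) (column y K)" for K
  let ?S = "{(x, c), (y, d)}"
  have rc: "parcs (row a F) \<inter> parcs (column b K) = {}"
    if "parcs F \<subseteq> parcs G" for a b F and K :: "'b pair_pre_digraph"
    using row_column_disjoint[OF G that] .
  have T: "strong_subgraph (G \<box> H) ?S (T F)" if F: "F \<in> \<G>" for F
  proof (cases "F = G0")
    case True
    have "strong_pair (T F)"
      unfolding T_def if_P[OF True]
      apply (rule strong_pair_join[where z = "(y, c)"])
      using \<G>D[OF G0(1)] \<H>D[OF H0(1)] by (auto intro: strong_pair_image)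
    moreover have "pverts (T F) \<subseteq> pverts (G \<box> H)" "parcs (T F) \<subseteq> parcs (G \<box> H)"
      using row_subgraph[OF \<G>D(3)[OF G0(1)] \<G>D(1)[OF G0(1)] \<G>D(2)[OF G0(1)] cd(1)]
        column_subgraph[OF \<H>D(3)[OF H0(1)] \<H>D(1)[OF H0(1)] \<H>D(2)[OF H0(1)] xy(2)]
      unfolding T_def if_P[OF True] graph_join_simps by blast+
    moreover have "?S \<subseteq> pverts (T F)"
      using \<G>D(4)[OF G0(1)] \<H>D(5)[OF H0(1)] True by (auto simp: T_def)
    ultimately show ?thesis
      by (simp add: strong_subgraph_iff[OF GH])
  next
    case False
    have uF: "u F \<in> pverts G"
      using u[OF F] \<G>D(1)[OF F] by auto
    have "strong_pair (T F)"
      unfolding T_def if_not_P[OF False]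
      apply (rule strong_pair_join[where z = "(u F, d)"])
      apply (rule strong_pair_join[where z = "(u F, c)"])
      using \<G>D[OF F] sH u[OF F] cd by (auto intro: strong_pair_image)
    moreover have "pverts (T F) \<subseteq> pverts (G \<box> H)" "parcs (T F) \<subseteq> parcs (G \<box> H)"
      using row_subgraph[OF \<G>D(3)[OF F] \<G>D(1)[OF F] \<G>D(2)[OF F] cd(1)]
        row_subgraph[OF \<G>D(3)[OF F] \<G>D(1)[OF F] \<G>D(2)[OF F] cd(2)]
        column_subgraph[OF sH order_refl order_refl uF]
      unfolding T_def if_not_P[OF False] graph_join_simps by (simp_all only: Un_subset_iff)
    moreover have "?S \<subseteq> pverts (T F)"
      using \<G>D(4,5)[OF F] False by (auto simp: T_def)
    ultimately show ?thesis
      by (simp add: strong_subgraph_iff[OF GH])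
  qed
  have U: "strong_subgraph (G \<box> H) ?S (U K)" if K: "K \<in> \<H>" for K
  proof -
    have vK: "v K \<in> pverts H"
      using v[OF K] \<H>D(1)[OF K] by auto
    have "strong_pair (U K)"
      unfolding U_def
      apply (rule strong_pair_join[where z = "(y, v K)"])
      apply (rule strong_pair_join[where z = "(x, v K)"])
      using \<H>D[OF K] sG v[OF K] xy by (auto intro: strong_pair_image)
    moreover have "pverts (U K) \<subseteq> pverts (G \<box> H)" "parcs (U K) \<subseteq> parcs (G \<box> H)"
      using column_subgraph[OF \<H>D(3)[OF K] \<H>D(1)[OF K] \<H>D(2)[OF K] xy(1)]
        column_subgraph[OF \<H>D(3)[OF K] \<H>D(1)[OF K] \<H>D(2)[OF K] xy(2)]
        row_subgraph[OF sG order_refl order_refl vK]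
      unfolding U_def graph_join_simps by (simp_all only: Un_subset_iff)
    moreover have "?S \<subseteq> pverts (U K)"
      using \<H>D(4,5)[OF K] by (auto simp: U_def)
    ultimately show ?thesis
      by (simp add: strong_subgraph_iff[OF GH])
  qed
  \<comment> \<open>The tying row \<open>v K\<close> avoids rows \<open>c\<close> and
    \<open>d\<close>, the tying column \<open>u F\<close> avoids columns \<open>x\<close> and
    \<open>y\<close>, and in column \<open>y\<close> the copy of \<open>H0\<close> is arc-disjoint
    from that of \<open>K\<close>.\<close>
  have TU: "parcs (T F) \<inter> parcs (U K) = {}" if "F \<in> \<G>" "K \<in> \<H>" "K \<noteq> H0" for F K
  proof -
    have "parcs (row c F) \<inter> parcs (row (v K) G) = {}" "parcs (row d F) \<inter> parcs (row (v K) G) = {}"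
      using v[OF that(2)] vd[OF that(2,3)] row_row_disjoint[of c "v K" F G] row_row_disjoint[of d "v K" F G]
      by blast+
    moreover have "parcs (column (u F) H) \<inter> parcs (column x K) = {}"
      using u[OF that(1)] by (intro column_column_disjoint) simp
    moreover have "parcs (column (u F) H) \<inter> parcs (column y K) = {}" if "F \<noteq> G0"
      using uy[OF \<open>F \<in> \<G>\<close> that] by (intro column_column_disjoint) simp
    moreover have "parcs (column y H0) \<inter> parcs (column b K) = {}" for b
      using \<H>disj[OF H0(1) that(2)] that(3) by (intro column_column_disjoint) auto
    ultimately show ?thesis
      using rc[OF \<G>D(2)[OF that(1)]] rc[OF order_refl] unfolding T_def U_def
      by (cases "F = G0") (simp_all only: if_True if_False refl graph_join_simps, blast+)
  qed
  \<comment> \<open>At most one of two distinct members is \<open>G0\<close>, so by symmetry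
    \<open>F'\<close> may be assumed to be an ordinary one; the restriction is lifted right
    afterwards.\<close>
  have TT: "parcs (T F) \<inter> parcs (T F') = {}" if "F \<in> \<G>" "F' \<in> \<G>" "F \<noteq> F'" "F' \<noteq> G0" for F F'
  proof -
    have "parcs (row a F) \<inter> parcs (row b F') = {}" for a b :: 'b
      using \<G>disj[OF that(1,2,3)] by (intro row_row_disjoint) simp
    moreover have "u F \<noteq> u F'"
      using inju that by (auto dest: inj_onD)
    then have "parcs (column (u F) H) \<inter> parcs (column (u F') H) = {}"
      by (intro column_column_disjoint) simp
    moreover have "parcs (column y H0) \<inter> parcs (column (u F') H) = {}"
      using uy[OF that(2,4)] by (intro column_column_disjoint) auto
    ultimately show ?thesis
      using rc[OF \<G>D(2)[OF that(1)]] rc[OF \<G>D(2)[OF that(2)]] that(4) unfolding T_def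
      by (cases "F = G0") (simp_all only: if_True if_False refl graph_join_simps, blast+)
  qed
  have TT: "parcs (T F) \<inter> parcs (T F') = {}" if "F \<in> \<G>" "F' \<in> \<G>" "F \<noteq> F'" for F F'
    using TT[OF that] TT[OF that(2,1)] that(3) by (metis Int_commute)
  have UU: "parcs (U K) \<inter> parcs (U L) = {}" if "K \<in> \<H>" "L \<in> \<H>" "K \<noteq> L" for K L
  proof -
    have "v K \<noteq> v L"
      using injv that by (auto dest: inj_onD)
    then have "parcs (row (v K) G) \<inter> parcs (row (v L) G) = {}"
      by (intro row_row_disjoint) simp
    moreover have "parcs (column a K) \<inter> parcs (column b L) = {}" for a b :: 'a
      using \<H>disj[OF that] by (intro column_column_disjoint) simp
    ultimately show ?thesis
      using rc[OF order_refl] unfolding U_def graph_join_simps by blast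
  qed
  \<comment> \<open>\<open>H0\<close> is removed because its copy in column \<open>y\<close> already
    belongs to \<open>T G0\<close>. This is the lost unit.\<close>
  let ?I = "\<G> <+> (\<H> - {H0})"
  have "card ?I \<le> lambda_S (G \<box> H) ?S"
  proof (rule card_le_lambda_S[OF GH, where F = "case_sum T U"])
    show "card ?S = 2"
      using xy by simp
    show "strong_subgraph (G \<box> H) ?S (case_sum T U i)" if "i \<in> ?I" for i
      using that T U by auto
    show "parcs (case_sum T U i) \<inter> parcs (case_sum T U j) = {}"
      if "i \<in> ?I" "j \<in> ?I" "i \<noteq> j" for i j
    proof (cases i; cases j)
      fix F F' assume "i = Inl F" "j = Inl F'"
      then show ?thesis using that TT[of F F'] by auto
    next
      fix F K assume "i = Inl F" "j = Inr K"
      then show ?thesis using that TU[of F K] by auto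
    next
      fix F K assume "i = Inr K" "j = Inl F"
      then show ?thesis using that TU[of F K] by auto
    next
      fix K L assume "i = Inr K" "j = Inr L"
      then show ?thesis using that UU[of K L] by auto
    qed
  qed
  moreover have "card ?I + 1 = card \<G> + card \<H>"
    using fin H0(1) card_Suc_Diff1[OF fin(2) H0(1)] by (simp add: card_Plus)
  ultimately show ?thesis
    using \<G>(2) \<H>(2) by simp
qed

section \<open>Passing to the minimum over all pairs\<close>

lemma obtain_other_member:
  assumes "2 \<le> card A"
  obtains z where "z \<in> A" "a \<noteq> z"
proof -
  obtain S where "S \<subseteq> A" "card S = 2"
    using obtain_subset_with_card_n[OF assms] by metis
  then show ?thesis
    using that card_2_distinct_members[of S] by (metis subsetD)
qed

theorem theorem4p2:
  fixes G :: "'a pair_pre_digraph" and H :: "'b pair_pre_digraph"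
  assumes "pair_digraph G" and "pair_digraph H"
    and "strongly_connected (with_proj G)" and "strongly_connected (with_proj H)"
    and "2 \<le> card (pverts G)" and "2 \<le> card (pverts H)"
  shows "int (lambda_2 (G \<box> H)) \<ge> int (lambda_2 G) + int (lambda_2 H) - 1"
proof -
  interpret G: pair_digraph G by fact
  interpret H: pair_digraph H by fact
  have sG: "strong_pair G"
    using assms(3) G.wf_digraph by (simp add: strong_pair_iff)
  have sH: "strong_pair H"
    using assms(4) H.wf_digraph by (simp add: strong_pair_iff)
  have GH: "pair_digraph (G \<box> H)"
    using assms(1,2) by (rule pair_digraph_cartesian_product)
  have verts: "pverts (G \<box> H) = pverts G \<times> pverts H"
    by (simp add: cartesian_product_def)
  have lG: "lambda_2 G \<le> lambda_S G {x, y}" if "x \<in> pverts G" "y \<in> pverts G" "x \<noteq> y" for x y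
    using that by (intro lambda_2_le_lambda_S assms(1)) auto
  have lH: "lambda_2 H \<le> lambda_S H {x, y}" if "x \<in> pverts H" "y \<in> pverts H" "x \<noteq> y" for x y
    using that by (intro lambda_2_le_lambda_S assms(2)) auto
  \<comment> \<open>The unit stands on the right-hand side to avoid truncated subtraction on
    \<open>nat\<close>.\<close>
  have bound: "lambda_2 G + lambda_2 H \<le> lambda_S (G \<box> H) S + 1"
    if S: "S \<subseteq> pverts (G \<box> H)" "card S = 2" for S
  proof -
    obtain x c y d where S_eq: "S = {(x, c), (y, d)}" and neq: "(x, c) \<noteq> (y, d)"
      using S(2) by (auto simp: card_2_iff)
    have mem: "x \<in> pverts G" "y \<in> pverts G" "c \<in> pverts H" "d \<in> pverts H"
      using S(1) by (auto simp: S_eq verts)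
    consider "x \<noteq> y" "c \<noteq> d" | "x \<noteq> y" "c = d" | "x = y" "c \<noteq> d"
      using neq by auto
    then show ?thesis
    proof cases
      case 1
      show ?thesis
        using lambda_S_product_general[OF assms(1,2) sG sH mem(1,2) 1(1) mem(3,4) 1(2)]
          lG[OF mem(1,2) 1(1)] lH[OF mem(3,4) 1(2)] by (simp add: S_eq)
    next
      case 2
      \<comment> \<open>With equal \<open>H\<close>-coordinates, a second vertex of \<open>H\<close>
        is needed to form a pair to which \<open>lambda_2 H\<close> applies; it exists because
        \<open>H\<close> has order at least 2.\<close>
      obtain z where z: "z \<in> pverts H" "c \<noteq> z"
        using obtain_other_member[OF assms(6)] .
      show ?thesis
        using lambda_S_product_same_row[OF assms(1,2) sG mem(1,2) 2(1) mem(3) z]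
          lG[OF mem(1,2) 2(1)] lH[OF mem(3) z] 2(2) by (simp add: S_eq)
    next
      case 3
      obtain z where z: "z \<in> pverts G" "x \<noteq> z"
        using obtain_other_member[OF assms(5)] .
      show ?thesis
        using lambda_S_product_same_column[OF assms(1,2) sH mem(3,4) 3(2) mem(1) z]
          lG[OF mem(1) z] lH[OF mem(3,4) 3(2)] 3(1) by (simp add: S_eq)
    qed
  qed
  \<comment> \<open>The product has at least two vertices, so the minimum ranges over a nonempty set
    and is attained by some pair.\<close>
  have "2 * 2 \<le> card (pverts (G \<box> H))"
    unfolding verts card_cartesian_product using assms(5,6) by (rule mult_le_mono)
  then have "lambda_2 (G \<box> H) \<in> {lambda_S (G \<box> H) S | S. S \<subseteq> pverts (G \<box> H) \<and> card S = 2}"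
    unfolding lambda_2_def
    using finite_lambda_S_values[OF GH] by (intro Min_in lambda_S_values_nonempty) auto
  then obtain S where "lambda_2 (G \<box> H) = lambda_S (G \<box> H) S"
      "S \<subseteq> pverts (G \<box> H)" "card S = 2"
    by blast
  then show ?thesis
    using bound[of S] by simp
qed

end
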